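(* For any two graded posets $P$ and $Q$, $$F_B(P\diamond Q)=F_B(P)\cdot F_B(Q).$$
   Context: All graded posets are finite, with minimal element $\widehat 0$, maximal element $\widehat 1$ and rank function $\rho$; $\rho(x,y)=\rho(y)-\rho(x)$. The quasisymmetric function of a graded poset $P$ is $F(P)=\lim_{m\to\infty}\sum_{\widehat 0=x_0\le x_1\le\cdots\le x_m=\widehat 1}t_1^{\rho(x_0,x_1)}t_2^{\rho(x_1,x_2)}\cdots t_m^{\rho(x_{m-1},x_m)}$, an element of the algebra $\mathrm{QSym}$ of quasisymmetric functions in $t_1,t_2,\ldots$ (over a field $\mathbf{k}$); for the one-element poset it equals $1$. Let $\mathrm{BQSym}=\mathbf{k}[s]\otimes\mathrm{QSym}$, the algebra of type $B$ quasisymmetric functions, viewed as polynomials in the extra variable $s$ with coefficients in $\mathrm{QSym}$. The type $B$ quasisymmetric function of $P$ is $$F_B(P)=\sum_{\widehat 0<x\le\widehat 1}s^{\rho(x)-1}\cdot F([x,\widehat 1])\in\mathrm{BQSym}.$$ The diamond product of posets is $P\diamond Q=(P-\{\widehat 0\})\times(Q-\{\widehat 0\})\cup\{\widehat 0\}$, i.e. the Cartesian product of $P-\{\widehat 0_P\}$ and $Q-\{\widehat 0_Q\}$ with a new minimal element adjoined. *)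

theory Defs
  imports "HOL-Library.Poly_Mapping" "HOL-Computational_Algebra.Polynomial"
begin

section \<open>Formal power series in countably many variables\<close>

text \<open>A series is its family of coefficients, indexed by the finitely supported exponent vectors.
  Indices start at \<open>0\<close>: index \<open>i\<close> stands for the variable usually written \<open>t\<^sub>i\<^sub>+\<^sub>1\<close>.\<close>

typedef 'a mfps = "UNIV :: ((nat \<Rightarrow>\<^sub>0 nat) \<Rightarrow> 'a) set"
  morphisms mcoeff Abs_mfps ..

setup_lifting type_definition_mfps

lemma mcoeff_Abs [simp]: "mcoeff (Abs_mfps f) = f"
  by (simp add: Abs_mfps_inverse)

lemma mfps_eqI: "(\<And>\<mu>. mcoeff f \<mu> = mcoeff g \<mu>) \<Longrightarrow> f = g"
  by transfer auto

definition splits :: "(nat \<Rightarrow>\<^sub>0 nat) \<Rightarrow> ((nat \<Rightarrow>\<^sub>0 nat) \<times> (nat \<Rightarrow>\<^sub>0 nat)) set" where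
  "splits \<mu> = {(\<alpha>, \<beta>). \<alpha> + \<beta> = \<mu>}"

lemma finite_splits [simp]: "finite (splits \<mu>)"
proof -
  define B where "B = Max (insert 0 (Poly_Mapping.lookup \<mu> ` Poly_Mapping.keys \<mu>))"
  define S where "S = {f :: nat \<Rightarrow> nat. \<forall>x. (x \<in> Poly_Mapping.keys \<mu> \<longrightarrow> f x \<in> {..B}) \<and> (x \<notin> Poly_Mapping.keys \<mu> \<longrightarrow> f x = 0)}"
  have finS: "finite S"
    unfolding S_def by (rule finite_set_of_finite_funs) auto
  have "Poly_Mapping.lookup \<alpha> \<in> S" if "\<alpha> + \<beta> = \<mu>" for \<alpha> \<beta>
  proof -
    have le: "Poly_Mapping.lookup \<alpha> x \<le> Poly_Mapping.lookup \<mu> x" for x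
      by (simp add: that [symmetric] lookup_add)
    have "Poly_Mapping.lookup \<mu> x \<le> B" if "x \<in> Poly_Mapping.keys \<mu>" for x
      unfolding B_def using that by (intro Max_ge) auto
    then show ?thesis
      unfolding S_def using le
      by (smt (verit, best) atMost_iff in_keys_iff le_trans le_zero_eq mem_Collect_eq)
  qed
  moreover have "Poly_Mapping.lookup \<beta> \<in> S" if "\<alpha> + \<beta> = \<mu>" for \<alpha> \<beta>
    using calculation [of \<beta> \<alpha>] that by (simp add: add.commute)
  ultimately have "map_prod Poly_Mapping.lookup Poly_Mapping.lookup ` splits \<mu> \<subseteq> S \<times> S"
    by (auto simp: splits_def)
  then have "finite (map_prod Poly_Mapping.lookup Poly_Mapping.lookup ` splits \<mu>)"
    by (rule finite_subset) (simp add: finS)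
  moreover have "inj_on (map_prod Poly_Mapping.lookup Poly_Mapping.lookup) (splits \<mu>)"
    by (auto simp: inj_on_def poly_mapping.lookup_inject)
  ultimately show ?thesis
    by (rule finite_imageD)
qed

lemma sum_splits_swap: "(\<Sum>(\<alpha>, \<beta>)\<in>splits \<mu>. h \<alpha> \<beta>) = (\<Sum>(\<alpha>, \<beta>)\<in>splits \<mu>. h \<beta> \<alpha>)"
  for h :: "_ \<Rightarrow> _ \<Rightarrow> 'a::comm_monoid_add"
  by (rule sum.reindex_bij_witness [of _ prod.swap prod.swap])
     (auto simp: splits_def add.commute)

lemma sum_splits_assoc:
  fixes h :: "_ \<Rightarrow> _ \<Rightarrow> _ \<Rightarrow> 'a::comm_monoid_add"
  shows "(\<Sum>(\<alpha>, \<beta>)\<in>splits \<mu>. \<Sum>(\<gamma>, \<delta>)\<in>splits \<alpha>. h \<gamma> \<delta> \<beta>)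
       = (\<Sum>(\<alpha>, \<beta>)\<in>splits \<mu>. \<Sum>(\<gamma>, \<delta>)\<in>splits \<beta>. h \<alpha> \<gamma> \<delta>)"
proof -
  have "(\<Sum>(\<alpha>, \<beta>)\<in>splits \<mu>. \<Sum>(\<gamma>, \<delta>)\<in>splits \<alpha>. h \<gamma> \<delta> \<beta>)
      = (\<Sum>(p, q)\<in>(SIGMA p:splits \<mu>. splits (fst p)). h (fst q) (snd q) (snd p))"
    by (subst sum.Sigma [symmetric]) (auto simp: case_prod_unfold)
  also have "\<dots> = (\<Sum>(p, q)\<in>(SIGMA p:splits \<mu>. splits (snd p)). h (fst p) (fst q) (snd q))"
    by (rule sum.reindex_bij_witness
          [of _ "\<lambda>((a, b), (c, d)). ((a + c, d), (a, c))" "\<lambda>((a, b), (c, d)). ((c, d + b), (d, b))"])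
       (auto simp: splits_def add.assoc)
  also have "\<dots> = (\<Sum>(\<alpha>, \<beta>)\<in>splits \<mu>. \<Sum>(\<gamma>, \<delta>)\<in>splits \<beta>. h \<alpha> \<gamma> \<delta>)"
    by (subst sum.Sigma [symmetric]) (auto simp: case_prod_unfold)
  finally show ?thesis .
qed

lemma sum_splits_zero_left:
  fixes h :: "_ \<Rightarrow> _ \<Rightarrow> 'a::comm_monoid_add"
  assumes "\<And>\<alpha> \<beta>. \<alpha> \<noteq> 0 \<Longrightarrow> h \<alpha> \<beta> = 0"
  shows "(\<Sum>(\<alpha>, \<beta>)\<in>splits \<mu>. h \<alpha> \<beta>) = h 0 \<mu>"
proof -
  have "(\<Sum>(\<alpha>, \<beta>)\<in>splits \<mu>. h \<alpha> \<beta>) = (\<Sum>(\<alpha>, \<beta>)\<in>{(0, \<mu>)}. h \<alpha> \<beta>)"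
  proof (rule sum.mono_neutral_right)
    show "{(0, \<mu>)} \<subseteq> splits \<mu>" by (simp add: splits_def)
    show "\<forall>p\<in>splits \<mu> - {(0, \<mu>)}. (case p of (\<alpha>, \<beta>) \<Rightarrow> h \<alpha> \<beta>) = 0"
    proof
      fix p assume p: "p \<in> splits \<mu> - {(0, \<mu>)}"
      obtain \<alpha> \<beta> where eq: "p = (\<alpha>, \<beta>)" by (cases p)
      have "\<alpha> \<noteq> 0"
      proof
        assume "\<alpha> = 0"
        with p have "\<beta> = \<mu>" "\<beta> \<noteq> \<mu>" by (simp_all add: eq splits_def)
        then show False by simp
      qed
      then show "(case p of (\<alpha>, \<beta>) \<Rightarrow> h \<alpha> \<beta>) = 0" by (simp add: eq assms)
    qed
  qed simp
  then show ?thesis by simp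
qed

instantiation mfps :: (comm_ring_1) comm_ring_1
begin

lift_definition zero_mfps :: "'a mfps" is "\<lambda>_. 0" .
lift_definition one_mfps :: "'a mfps" is "\<lambda>\<mu>. if \<mu> = 0 then 1 else 0" .
lift_definition plus_mfps :: "'a mfps \<Rightarrow> 'a mfps \<Rightarrow> 'a mfps" is "\<lambda>f g \<mu>. f \<mu> + g \<mu>" .
lift_definition minus_mfps :: "'a mfps \<Rightarrow> 'a mfps \<Rightarrow> 'a mfps" is "\<lambda>f g \<mu>. f \<mu> - g \<mu>" .
lift_definition uminus_mfps :: "'a mfps \<Rightarrow> 'a mfps" is "\<lambda>f \<mu>. - f \<mu>" .
lift_definition times_mfps :: "'a mfps \<Rightarrow> 'a mfps \<Rightarrow> 'a mfps"
  is "\<lambda>f g \<mu>. \<Sum>(\<alpha>, \<beta>)\<in>splits \<mu>. f \<alpha> * g \<beta>" .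

instance
proof
  fix a b c :: "'a mfps"
  show "a + b + c = a + (b + c)" by transfer (auto simp: add.assoc)
  show "a + b = b + a" by transfer (auto simp: add.commute)
  show "0 + a = a" by transfer auto
  show "- a + a = 0" by transfer auto
  show "a - b = a + - b" by transfer auto
  show "a * b * c = a * (b * c)"
  proof (transfer, rule ext)
    fix f g h :: "(nat \<Rightarrow>\<^sub>0 nat) \<Rightarrow> 'a" and \<mu>
    show "(\<Sum>(\<alpha>, \<beta>)\<in>splits \<mu>. (\<Sum>(\<gamma>, \<delta>)\<in>splits \<alpha>. f \<gamma> * g \<delta>) * h \<beta>)
        = (\<Sum>(\<alpha>, \<beta>)\<in>splits \<mu>. f \<alpha> * (\<Sum>(\<gamma>, \<delta>)\<in>splits \<beta>. g \<gamma> * h \<delta>))"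
      using sum_splits_assoc [of "\<lambda>x y z. f x * (g y * h z)" \<mu>]
      by (simp add: case_prod_unfold sum_distrib_left sum_distrib_right mult.assoc)
  qed
  show "a * b = b * a"
    by transfer
       (rule ext, subst sum_splits_swap, simp add: mult.commute)
  show "1 * a = a"
    by transfer (rule ext, subst sum_splits_zero_left, auto)
  show "(a + b) * c = a * c + b * c"
    by transfer (auto simp: case_prod_unfold distrib_right sum.distrib)
  show "(0 :: 'a mfps) \<noteq> 1"
    by transfer (metis zero_neq_one)
qed

end

definition tvar :: "nat \<Rightarrow> 'a::comm_ring_1 mfps" where
  "tvar i = Abs_mfps (\<lambda>\<mu>. if \<mu> = Poly_Mapping.single i 1 then 1 else 0)"

section \<open>Quasisymmetric functions\<close>

text \<open>The nonzero exponents of a monomial, in increasing order of the variables: for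
  \<open>i\<^sub>1 < \<dots> < i\<^sub>k\<close> and positive \<open>a\<^sub>1, \<dots>, a\<^sub>k\<close> the monomial with exponent
  \<open>a\<^sub>j\<close> at \<open>i\<^sub>j\<close> is sent to \<open>[a\<^sub>1, \<dots>, a\<^sub>k]\<close>.\<close>

definition exponents :: "(nat \<Rightarrow>\<^sub>0 nat) \<Rightarrow> nat list" where
  "exponents \<mu> = map (Poly_Mapping.lookup \<mu>) (sorted_list_of_set (Poly_Mapping.keys \<mu>))"

definition QSym :: "'a::comm_ring_1 mfps set" where
  "QSym = {f. (\<exists>d. \<forall>\<mu>. mcoeff f \<mu> \<noteq> 0 \<longrightarrow> sum_list (exponents \<mu>) \<le> d) \<and>
              (\<forall>\<mu> \<nu>. exponents \<mu> = exponents \<nu> \<longrightarrow> mcoeff f \<mu> = mcoeff f \<nu>)}"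

text \<open>The variable of the polynomial ring is \<open>s\<close>; the tensor product \<open>k[s] \<otimes> QSym\<close> is the ring of
  polynomials in \<open>s\<close> all of whose coefficients are quasisymmetric.\<close>

definition BQSym :: "'a::comm_ring_1 mfps poly set" where
  "BQSym = {p. \<forall>n. coeff p n \<in> QSym}"

section \<open>Graded posets\<close>

text \<open>A poset is given by its order relation, \<open>(x, y) \<in> P\<close> meaning \<open>x \<le> y\<close>; by reflexivity its
  underlying set is \<^term>\<open>Field P\<close>.\<close>

definition is_least :: "'a rel \<Rightarrow> 'a \<Rightarrow> bool" where
  "is_least P x \<longleftrightarrow> x \<in> Field P \<and> (\<forall>y\<in>Field P. (x, y) \<in> P)"

definition is_greatest :: "'a rel \<Rightarrow> 'a \<Rightarrow> bool" where
  "is_greatest P x \<longleftrightarrow> x \<in> Field P \<and> (\<forall>y\<in>Field P. (y, x) \<in> P)"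

definition zero_hat :: "'a rel \<Rightarrow> 'a" where
  "zero_hat P = (THE x. is_least P x)"

definition one_hat :: "'a rel \<Rightarrow> 'a" where
  "one_hat P = (THE x. is_greatest P x)"

definition covers :: "'a rel \<Rightarrow> 'a \<Rightarrow> 'a \<Rightarrow> bool" where
  "covers P x y \<longleftrightarrow> (x, y) \<in> P \<and> x \<noteq> y \<and> (\<forall>z. (x, z) \<in> P \<and> (z, y) \<in> P \<longrightarrow> z = x \<or> z = y)"

definition is_rank :: "'a rel \<Rightarrow> ('a \<Rightarrow> nat) \<Rightarrow> bool" where
  "is_rank P \<rho> \<longleftrightarrow> \<rho> (zero_hat P) = 0 \<and> (\<forall>x y. covers P x y \<longrightarrow> \<rho> y = \<rho> x + 1)"

definition graded_poset :: "'a rel \<Rightarrow> bool" where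
  "graded_poset P \<longleftrightarrow> Partial_order P \<and> finite (Field P) \<and>
     (\<exists>x. is_least P x) \<and> (\<exists>x. is_greatest P x) \<and> (\<exists>\<rho>. is_rank P \<rho>)"

text \<open>A rank function is only determined on \<^term>\<open>Field P\<close>, and is only used there.\<close>

definition rk :: "'a rel \<Rightarrow> 'a \<Rightarrow> nat" where
  "rk P = (SOME \<rho>. is_rank P \<rho>)"

definition rk_diff :: "'a rel \<Rightarrow> 'a \<Rightarrow> 'a \<Rightarrow> nat" where
  "rk_diff P x y = rk P y - rk P x"

definition interval :: "'a rel \<Rightarrow> 'a \<Rightarrow> 'a \<Rightarrow> 'a rel" where
  "interval P x y = Restr P {z. (x, z) \<in> P \<and> (z, y) \<in> P}"

text \<open>In the diamond product \<^term>\<open>None\<close> is the new minimal element.\<close>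

definition diamond :: "'a rel \<Rightarrow> 'b rel \<Rightarrow> ('a \<times> 'b) option rel"  (infixl "\<diamondop>" 70) where
  "P \<diamondop> Q =
     {(Some (x, y), Some (x', y')) | x y x' y'.
        x \<in> Field P - {zero_hat P} \<and> x' \<in> Field P - {zero_hat P} \<and>
        y \<in> Field Q - {zero_hat Q} \<and> y' \<in> Field Q - {zero_hat Q} \<and>
        (x, x') \<in> P \<and> (y, y') \<in> Q} \<union>
     {(None, Some (x, y)) | x y. x \<in> Field P - {zero_hat P} \<and> y \<in> Field Q - {zero_hat Q}} \<union>
     {(None, None)}"

section \<open>The quasisymmetric functions of a graded poset\<close>

definition multichains :: "'a rel \<Rightarrow> nat \<Rightarrow> 'a list set" where
  "multichains P m = {xs. length xs = Suc m \<and> xs ! 0 = zero_hat P \<and> xs ! m = one_hat P \<and>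
                          (\<forall>i<m. (xs ! i, xs ! Suc i) \<in> P)}"

definition F_approx :: "'a rel \<Rightarrow> nat \<Rightarrow> 'k::field mfps" where
  "F_approx P m = (\<Sum>xs\<in>multichains P m. \<Prod>i<m. tvar i ^ rk_diff P (xs ! i) (xs ! Suc i))"

text \<open>The limit is taken in the ring of formal power series: every coefficient is eventually
  constant (see \<open>F_approx_converges\<close> below).\<close>

definition F :: "'a rel \<Rightarrow> 'k::field mfps" where
  "F P = Abs_mfps (\<lambda>\<mu>. THE c. \<forall>\<^sub>F m in sequentially. mcoeff (F_approx P m) \<mu> = c)"

definition F_B :: "'a rel \<Rightarrow> 'k::field mfps poly" where
  "F_B P = (\<Sum>x\<in>Field P - {zero_hat P}. monom (F (interval P x (one_hat P))) (rk P x - 1))"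

section \<open>Well-definedness\<close>

lemma zero_hat_eq: "Partial_order P \<Longrightarrow> is_least P x \<Longrightarrow> zero_hat P = x"
  unfolding zero_hat_def is_least_def partial_order_on_def antisym_def by blast

lemma one_hat_eq: "Partial_order P \<Longrightarrow> is_greatest P x \<Longrightarrow> one_hat P = x"
  unfolding one_hat_def is_greatest_def partial_order_on_def antisym_def by blast

lemma
  assumes "graded_poset P"
  shows graded_refl: "x \<in> Field P \<Longrightarrow> (x, x) \<in> P"
    and graded_trans: "(x, y) \<in> P \<Longrightarrow> (y, z) \<in> P \<Longrightarrow> (x, z) \<in> P"
    and graded_antisym: "(x, y) \<in> P \<Longrightarrow> (y, x) \<in> P \<Longrightarrow> x = y"
    and graded_finite: "finite (Field P)"
    and zero_hat_least: "is_least P (zero_hat P)"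
    and one_hat_greatest: "is_greatest P (one_hat P)"
    and is_rank_rk: "is_rank P (rk P)"
proof -
  show "x \<in> Field P \<Longrightarrow> (x, x) \<in> P" "(x, y) \<in> P \<Longrightarrow> (y, z) \<in> P \<Longrightarrow> (x, z) \<in> P"
    "(x, y) \<in> P \<Longrightarrow> (y, x) \<in> P \<Longrightarrow> x = y" "finite (Field P)"
    using assms
    unfolding graded_poset_def partial_order_on_def preorder_on_def refl_on_def trans_def antisym_def
    by blast+
  show "is_least P (zero_hat P)" "is_greatest P (one_hat P)"
    using assms zero_hat_eq one_hat_eq unfolding graded_poset_def by metis+
  show "is_rank P (rk P)"
    using assms unfolding graded_poset_def rk_def by (metis someI_ex)
qed

lemma is_rank_strict_mono:
  assumes P: "graded_poset P" and \<rho>: "is_rank P \<rho>" and "(x, y) \<in> P" "x \<noteq> y"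
  shows "\<rho> x < \<rho> y"
  using assms(3,4)
proof (induction "card {z. (x, z) \<in> P \<and> (z, y) \<in> P}" arbitrary: x y rule: less_induct)
  case less
  show ?case
  proof (cases "covers P x y")
    case True
    then show ?thesis using \<rho> unfolding is_rank_def by force
  next
    case False
    then obtain z where z: "(x, z) \<in> P" "(z, y) \<in> P" "z \<noteq> x" "z \<noteq> y"
      using less.prems unfolding covers_def by blast
    have fin: "finite {w. (x, w) \<in> P \<and> (w, y) \<in> P}"
      by (rule finite_subset [OF _ graded_finite [OF P]]) (auto intro: FieldI1 FieldI2)
    have y: "(y, y) \<in> P" and x: "(x, x) \<in> P"
      using less.prems P by (auto intro: graded_refl FieldI1 FieldI2)
    define A where "A = {w. (x, w) \<in> P \<and> (w, z) \<in> P}"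
    define B where "B = {w. (z, w) \<in> P \<and> (w, y) \<in> P}"
    define C where "C = {w. (x, w) \<in> P \<and> (w, y) \<in> P}"
    have "y \<notin> A" "x \<notin> B"
      using graded_antisym [OF P z(1)] graded_antisym [OF P z(2)] z(3,4) unfolding A_def B_def by blast+
    moreover have "y \<in> C" "x \<in> C"
      using less.prems x y unfolding C_def by blast+
    moreover have "A \<subseteq> C"
      using graded_trans [OF P _ z(2)] unfolding A_def C_def by blast
    moreover have "B \<subseteq> C"
      using graded_trans [OF P z(1)] unfolding B_def C_def by blast
    ultimately have "A \<subset> C" "B \<subset> C"
      by auto
    then have "card A < card C" "card B < card C"
      using fin by (auto simp: C_def intro: psubset_card_mono)
    then have "\<rho> x < \<rho> z" "\<rho> z < \<rho> y"
      using less.hyps [of x z] less.hyps [of z y] z unfolding A_def B_def C_def by auto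
    then show ?thesis by simp
  qed
qed

lemma is_rank_unique:
  assumes P: "graded_poset P" and \<rho>: "is_rank P \<rho>" and \<sigma>: "is_rank P \<sigma>" and "x \<in> Field P"
  shows "\<rho> x = \<sigma> x"
  using assms(4)
proof (induction "\<rho> x" arbitrary: x rule: less_induct)
  case less
  show ?case
  proof (cases "x = zero_hat P")
    case True
    then show ?thesis using \<rho> \<sigma> unfolding is_rank_def by simp
  next
    case False
    define S where "S = {z. (z, x) \<in> P \<and> z \<noteq> x}"
    have "finite S"
      by (rule finite_subset [OF _ graded_finite [OF P]]) (auto simp: S_def intro: FieldI1)
    moreover have "zero_hat P \<in> S"
      using zero_hat_least [OF P] False less.prems unfolding S_def is_least_def by auto
    ultimately obtain z where z: "z \<in> S" "\<And>w. w \<in> S \<Longrightarrow> \<rho> w \<le> \<rho> z"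
      using Max_in [of "\<rho> ` S"] Max_ge [of "\<rho> ` S"] by (metis empty_iff finite_imageI image_iff imageI)
    have "covers P z x"
      unfolding covers_def
    proof (intro conjI allI impI)
      show "(z, x) \<in> P" "z \<noteq> x" using z by (auto simp: S_def)
      fix w assume w: "(z, w) \<in> P \<and> (w, x) \<in> P"
      show "w = z \<or> w = x"
      proof (rule ccontr)
        assume "\<not> (w = z \<or> w = x)"
        then have "w \<in> S" "\<rho> z < \<rho> w"
          using w is_rank_strict_mono [OF P \<rho>] by (auto simp: S_def)
        then show False using z(2) [of w] by simp
      qed
    qed
    then have "\<rho> x = \<rho> z + 1" "\<sigma> x = \<sigma> z + 1"
      using \<rho> \<sigma> unfolding is_rank_def by auto
    moreover have "z \<in> Field P" using z by (auto simp: S_def intro: FieldI1)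
    ultimately show ?thesis using less.hyps [of z] by simp
  qed
qed

lemma rk_eq: "graded_poset P \<Longrightarrow> is_rank P \<rho> \<Longrightarrow> x \<in> Field P \<Longrightarrow> rk P x = \<rho> x"
  using is_rank_unique is_rank_rk by metis

lemma rk_mono: "graded_poset P \<Longrightarrow> (x, y) \<in> P \<Longrightarrow> rk P x \<le> rk P y"
  using is_rank_strict_mono [OF _ is_rank_rk] by (metis less_imp_le order_refl)

lemma rk_diff_eq_0_iff:
  assumes "graded_poset P" "(x, y) \<in> P" shows "rk_diff P x y = 0 \<longleftrightarrow> x = y"
  using is_rank_strict_mono [OF assms(1) is_rank_rk [OF assms(1)] assms(2)]
  unfolding rk_diff_def by fastforce

lemma
  assumes P: "graded_poset P" and x: "x \<in> Field P"
  shows Field_upper_interval: "Field (interval P x (one_hat P)) = {z. (x, z) \<in> P}"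
    and graded_upper_interval: "graded_poset (interval P x (one_hat P))"
    and zero_hat_upper_interval: "zero_hat (interval P x (one_hat P)) = x"
    and one_hat_upper_interval: "one_hat (interval P x (one_hat P)) = one_hat P"
    and rk_upper_interval: "(x, y) \<in> P \<Longrightarrow> rk (interval P x (one_hat P)) y = rk P y - rk P x"
proof -
  let ?I = "interval P x (one_hat P)"
  have top: "(z, one_hat P) \<in> P" if "(x, z) \<in> P" for z
    using one_hat_greatest [OF P] that unfolding is_greatest_def by (auto intro: FieldI2)
  have mem: "(a, b) \<in> ?I \<longleftrightarrow> (x, a) \<in> P \<and> (a, b) \<in> P" for a b
    unfolding interval_def using top [of a] top [of b] graded_trans [OF P, of x a b] by blast
  show fld: "Field ?I = {z. (x, z) \<in> P}"
  proof (intro set_eqI iffI)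
    fix z assume "z \<in> Field ?I"
    then obtain w where "(z, w) \<in> ?I \<or> (w, z) \<in> ?I" unfolding Field_def by blast
    then show "z \<in> {z. (x, z) \<in> P}" using mem graded_trans [OF P, of x w z] by blast
  next
    fix z assume "z \<in> {z. (x, z) \<in> P}"
    then have "(z, z) \<in> ?I" using graded_refl [OF P FieldI2] by (auto simp: mem)
    then show "z \<in> Field ?I" by (rule FieldI1)
  qed
  have po: "Partial_order ?I"
    using P unfolding interval_def graded_poset_def by (auto intro: Partial_order_Restr)
  have least: "is_least ?I x"
    unfolding is_least_def fld using mem graded_refl [OF P x] by auto
  have greatest: "is_greatest ?I (one_hat P)"
    unfolding is_greatest_def fld using mem top graded_refl [OF P x] by auto
  show 0: "zero_hat ?I = x" and "one_hat ?I = one_hat P"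
    using zero_hat_eq [OF po least] one_hat_eq [OF po greatest] .
  have rank: "is_rank ?I (\<lambda>y. rk P y - rk P x)"
    unfolding is_rank_def 0
  proof (intro conjI allI impI)
    fix a b assume c: "covers ?I a b"
    then have "covers P a b"
      unfolding covers_def mem using graded_trans [OF P] by blast
    then have "rk P b = rk P a + 1"
      using is_rank_rk [OF P] unfolding is_rank_def by blast
    moreover have "rk P x \<le> rk P a"
      using c rk_mono [OF P] unfolding covers_def mem by blast
    ultimately show "rk P b - rk P x = rk P a - rk P x + 1" by simp
  qed simp
  have "finite (Field ?I)"
    by (rule finite_subset [OF _ graded_finite [OF P]]) (auto simp: fld intro: FieldI2)
  with po least greatest rank show g: "graded_poset ?I"
    unfolding graded_poset_def by blast
  show "(x, y) \<in> P \<Longrightarrow> rk ?I y = rk P y - rk P x"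
    by (rule rk_eq [OF g rank]) (simp add: fld)
qed

text \<open>The number of multichains from \<open>x\<close> to \<^term>\<open>one_hat P\<close> with prescribed rank jumps.\<close>

fun jump_count :: "'a rel \<Rightarrow> 'a \<Rightarrow> nat list \<Rightarrow> nat" where
  "jump_count P x [] = (if x = one_hat P then 1 else 0)"
| "jump_count P x (e # es) = (\<Sum>y | (x, y) \<in> P \<and> rk_diff P x y = e. jump_count P y es)"

lemma finite_above [simp]: "graded_poset P \<Longrightarrow> finite {y. (x, y) \<in> P \<and> R y}"
  by (rule finite_subset [OF _ graded_finite]) (auto intro: FieldI2)

lemma jump_count_filter:
  assumes "graded_poset P"
  shows "x \<in> Field P \<Longrightarrow> jump_count P x (filter (\<lambda>e. e \<noteq> 0) es) = jump_count P x es"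
proof (induction es arbitrary: x)
  case (Cons e es)
  show ?case
  proof (cases "e = 0")
    case True
    from True have "{y. (x, y) \<in> P \<and> rk_diff P x y = 0} = {x}"
      using rk_diff_eq_0_iff [OF assms, of x] graded_refl [OF assms Cons.prems] by auto
    then show ?thesis using True Cons by simp
  next
    case False
    have "jump_count P y (filter (\<lambda>e. e \<noteq> 0) es) = jump_count P y es" if "(x, y) \<in> P" for y
      using that by (intro Cons.IH FieldI2)
    then have "(\<Sum>y | (x, y) \<in> P \<and> rk_diff P x y = e. jump_count P y (filter (\<lambda>e. e \<noteq> 0) es))
        = (\<Sum>y | (x, y) \<in> P \<and> rk_diff P x y = e. jump_count P y es)"
      by (intro sum.cong) blast+
    with False show ?thesis
      by simp
  qed
qed simp

lemma jump_count_sum: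
  assumes "graded_poset P"
  shows "jump_count P x es \<noteq> 0 \<Longrightarrow> x \<in> Field P \<Longrightarrow> sum_list es = rk_diff P x (one_hat P)"
proof (induction es arbitrary: x)
  case Nil
  then show ?case by (simp add: rk_diff_def split: if_splits)
next
  case (Cons e es)
  from Cons.prems(1) have "(\<Sum>y | (x, y) \<in> P \<and> rk_diff P x y = e. jump_count P y es) \<noteq> 0"
    by simp
  then obtain y where y: "(x, y) \<in> P" "rk_diff P x y = e" "jump_count P y es \<noteq> 0"
    by (rule sum.not_neutral_contains_not_neutral) auto
  have fy: "y \<in> Field P" using y by (auto intro: FieldI2)
  then have "(y, one_hat P) \<in> P"
    using one_hat_greatest [OF assms] unfolding is_greatest_def by blast
  then show ?case
    using Cons.IH [OF y(3) fy] y rk_mono [OF assms] by (fastforce simp: rk_diff_def)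
qed

lemma jump_count_card:
  assumes "graded_poset P"
  shows "finite {xs. length xs = Suc (length es) \<and> xs ! 0 = x \<and> xs ! length es = one_hat P \<and>
           (\<forall>i<length es. (xs ! i, xs ! Suc i) \<in> P \<and> rk_diff P (xs ! i) (xs ! Suc i) = es ! i)} \<and>
         card {xs. length xs = Suc (length es) \<and> xs ! 0 = x \<and> xs ! length es = one_hat P \<and>
           (\<forall>i<length es. (xs ! i, xs ! Suc i) \<in> P \<and> rk_diff P (xs ! i) (xs ! Suc i) = es ! i)} =
         jump_count P x es"
proof (induction es arbitrary: x)
  case Nil
  have "{xs. length xs = Suc 0 \<and> xs ! 0 = x \<and> xs ! 0 = one_hat P}
      = (if x = one_hat P then {[x]} else {})"
    by (auto simp: length_Suc_conv)
  then show ?case by simp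
next
  case (Cons e es)
  let ?S = "\<lambda>es x. {xs. length xs = Suc (length es) \<and> xs ! 0 = x \<and> xs ! length es = one_hat P \<and>
           (\<forall>i<length es. (xs ! i, xs ! Suc i) \<in> P \<and> rk_diff P (xs ! i) (xs ! Suc i) = es ! i)}"
  let ?Y = "{y. (x, y) \<in> P \<and> rk_diff P x y = e}"
  have eq: "?S (e # es) x = (\<Union>y\<in>?Y. Cons x ` ?S es y)"
  proof (intro set_eqI iffI)
    fix xs assume xs: "xs \<in> ?S (e # es) x"
    then obtain x' ys where ys: "xs = x' # ys" by (cases xs) simp_all
    have "xs ! 0 = x" using xs by simp
    then have ys: "xs = x # ys" using ys by simp
    have step: "(xs ! i, xs ! Suc i) \<in> P \<and> rk_diff P (xs ! i) (xs ! Suc i) = (e # es) ! i"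
      if "i < Suc (length es)" for i
      using xs that by simp
    have "length ys = Suc (length es)" "ys ! length es = one_hat P"
      using xs by (simp_all add: ys)
    moreover have "(ys ! i, ys ! Suc i) \<in> P \<and> rk_diff P (ys ! i) (ys ! Suc i) = es ! i"
      if "i < length es" for i
      using step [of "Suc i"] that by (simp add: ys)
    ultimately have "ys \<in> ?S es (ys ! 0)"
      by simp
    moreover have "ys ! 0 \<in> ?Y"
      using step [of 0] by (simp add: ys)
    ultimately show "xs \<in> (\<Union>y\<in>?Y. Cons x ` ?S es y)"
      using ys by blast
  next
    fix xs assume "xs \<in> (\<Union>y\<in>?Y. Cons x ` ?S es y)"
    then obtain y ys where y: "y \<in> ?Y" and ys: "ys \<in> ?S es y" and xs: "xs = x # ys"
      by blast
    have "(xs ! i, xs ! Suc i) \<in> P \<and> rk_diff P (xs ! i) (xs ! Suc i) = (e # es) ! i"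
      if "i < Suc (length es)" for i
      using that y ys by (cases i) (simp_all add: xs)
    with ys show "xs \<in> ?S (e # es) x"
      by (simp add: xs)
  qed
  have fin: "finite (Cons x ` ?S es y)" for y
    using Cons.IH [of y] by blast
  have finY: "finite ?Y"
    using assms by simp
  have "card (\<Union>y\<in>?Y. Cons x ` ?S es y) = (\<Sum>y\<in>?Y. card (Cons x ` ?S es y))"
  proof (rule card_UN_disjoint [OF finY])
    show "\<forall>y\<in>?Y. finite (Cons x ` ?S es y)" using fin by blast
    show "\<forall>y\<in>?Y. \<forall>z\<in>?Y. y \<noteq> z \<longrightarrow> Cons x ` ?S es y \<inter> Cons x ` ?S es z = {}" by blast
  qed
  also have "\<dots> = (\<Sum>y\<in>?Y. card (?S es y))"
    by (simp add: card_image)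
  also have "\<dots> = (\<Sum>y\<in>?Y. jump_count P y es)"
    using Cons.IH by (intro sum.cong refl) blast
  also have "\<dots> = jump_count P x (e # es)"
    by simp
  finally have card: "card (?S (e # es) x) = jump_count P x (e # es)"
    by (simp only: eq)
  have "finite (?S (e # es) x)"
    unfolding eq using fin finY by (rule finite_UN_I [rotated])
  with card show ?case by blast
qed

definition mono_of :: "(nat \<Rightarrow>\<^sub>0 nat) \<Rightarrow> 'a::comm_ring_1 mfps" where
  "mono_of \<mu> = Abs_mfps (\<lambda>\<nu>. if \<nu> = \<mu> then 1 else 0)"

lemma mono_of_0: "mono_of 0 = 1"
  by (rule mfps_eqI) (simp add: mono_of_def one_mfps.rep_eq)

lemma mono_of_add: "mono_of (\<alpha> + \<beta>) = mono_of \<alpha> * mono_of \<beta>"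
proof (rule mfps_eqI)
  fix \<mu>
  have "mcoeff (mono_of \<alpha> * mono_of \<beta> :: 'a mfps) \<mu>
      = (\<Sum>p\<in>splits \<mu>. if p = (\<alpha>, \<beta>) then 1 else 0)"
    unfolding times_mfps.rep_eq by (rule sum.cong) (auto simp: mono_of_def split: if_splits)
  then show "mcoeff (mono_of (\<alpha> + \<beta>)) \<mu> = mcoeff (mono_of \<alpha> * mono_of \<beta> :: 'a mfps) \<mu>"
    by (simp add: sum.delta) (simp add: mono_of_def splits_def eq_commute)
qed

lemma tvar_power: "tvar i ^ n = mono_of (Poly_Mapping.single i n)"
proof (induction n)
  case (Suc n)
  have "Poly_Mapping.single i (Suc n) = Poly_Mapping.single i 1 + Poly_Mapping.single i n"
    by (simp flip: single_add)
  then show ?case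
    using Suc by (simp add: mono_of_add) (simp add: mono_of_def tvar_def)
qed (simp add: mono_of_0)

lemma prod_tvar: "(\<Prod>i<m. tvar i ^ e i) = mono_of (\<Sum>i<m. Poly_Mapping.single i (e i))"
  by (induction m) (auto simp: mono_of_0 mono_of_add tvar_power)

lemma lookup_sum_single:
  "Poly_Mapping.lookup (\<Sum>i<m. Poly_Mapping.single i (e i)) j = (if j < m then e j else 0)"
  for e :: "nat \<Rightarrow> nat"
  by (simp add: lookup_sum lookup_single when_def)

lemma mcoeff_sum: "mcoeff (\<Sum>x\<in>A. f x) \<mu> = (\<Sum>x\<in>A. mcoeff (f x) \<mu>)"
  by (induction A rule: infinite_finite_induct) (auto simp: zero_mfps.rep_eq plus_mfps.rep_eq)

lemma finite_multichains:
  assumes "graded_poset P" shows "finite (multichains P m)"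
proof -
  have "set xs \<subseteq> Field P" if "xs \<in> multichains P m" for xs
  proof
    fix x assume "x \<in> set xs"
    moreover have "length xs = Suc m" using that by (simp add: multichains_def)
    ultimately obtain i where i: "i \<le> m" "x = xs ! i"
      by (metis in_set_conv_nth less_Suc_eq_le)
    show "x \<in> Field P"
    proof (cases "i = m")
      case True
      then show ?thesis
        using i that one_hat_greatest [OF assms] by (auto simp: multichains_def is_greatest_def)
    next
      case False
      then have "(xs ! i, xs ! Suc i) \<in> P"
        using i that by (simp add: multichains_def)
      then show ?thesis
        unfolding i(2) by (rule FieldI1)
    qed
  qed
  then have "multichains P m \<subseteq> {xs. set xs \<subseteq> Field P \<and> length xs = Suc m}"
    by (auto simp: multichains_def)
  then show ?thesis
    using finite_lists_length_eq [OF graded_finite [OF assms]] finite_subset by blast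
qed

lemma filter_exponents:
  assumes "Poly_Mapping.keys \<mu> \<subseteq> {..<m}"
  shows "filter (\<lambda>e. e \<noteq> 0) (map (Poly_Mapping.lookup \<mu>) [0..<m]) = exponents \<mu>"
proof -
  have "sorted_list_of_set (Poly_Mapping.keys \<mu>) = filter (\<lambda>i. Poly_Mapping.lookup \<mu> i \<noteq> 0) [0..<m]"
    by (rule sorted_distinct_set_unique)
       (use assms in \<open>auto simp: in_keys_iff sorted_wrt_filter\<close>)
  then show ?thesis
    by (simp add: exponents_def filter_map comp_def)
qed

lemma mcoeff_F_approx:
  assumes P: "graded_poset P" and m: "Poly_Mapping.keys \<mu> \<subseteq> {..<m}"
  shows "mcoeff (F_approx P m :: 'k::field mfps) \<mu>
       = of_nat (jump_count P (zero_hat P) (exponents \<mu>))"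
proof -
  let ?e = "\<lambda>xs i. rk_diff P (xs ! i) (xs ! Suc i)"
  let ?es = "map (Poly_Mapping.lookup \<mu>) [0..<m]"
  have *: "\<mu> = (\<Sum>i<m. Poly_Mapping.single i (?e xs i)) \<longleftrightarrow> (\<forall>i<m. ?e xs i = Poly_Mapping.lookup \<mu> i)"
    for xs
  proof -
    have zero: "Poly_Mapping.lookup \<mu> j = 0" if "\<not> j < m" for j
      using m that by (metis in_keys_iff lessThan_iff subsetD)
    have "\<mu> = (\<Sum>i<m. Poly_Mapping.single i (?e xs i)) \<longleftrightarrow>
        (\<forall>j. Poly_Mapping.lookup \<mu> j = (if j < m then ?e xs j else 0))"
      by (subst poly_mapping_eq_iff, subst fun_eq_iff) (simp only: lookup_sum_single)
    also have "\<dots> \<longleftrightarrow> (\<forall>i<m. ?e xs i = Poly_Mapping.lookup \<mu> i)"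
      by (metis zero)
    finally show ?thesis .
  qed
  have "mcoeff (F_approx P m :: 'k mfps) \<mu>
      = (\<Sum>xs\<in>multichains P m. if \<forall>i<m. ?e xs i = Poly_Mapping.lookup \<mu> i then 1 else 0)"
    unfolding F_approx_def mcoeff_sum prod_tvar by (simp add: mono_of_def *)
  also have "\<dots> = of_nat (card {xs \<in> multichains P m. \<forall>i<m. ?e xs i = Poly_Mapping.lookup \<mu> i})"
    by (simp add: sum.If_cases finite_multichains [OF P] Int_def)
  also have "{xs \<in> multichains P m. \<forall>i<m. ?e xs i = Poly_Mapping.lookup \<mu> i}
      = {xs. length xs = Suc (length ?es) \<and> xs ! 0 = zero_hat P \<and> xs ! length ?es = one_hat P \<and>
           (\<forall>i<length ?es. (xs ! i, xs ! Suc i) \<in> P \<and> rk_diff P (xs ! i) (xs ! Suc i) = ?es ! i)}"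
    by (auto simp: multichains_def)
  also have "card \<dots> = jump_count P (zero_hat P) ?es"
    using jump_count_card [OF P] by blast
  also have "\<dots> = jump_count P (zero_hat P) (exponents \<mu>)"
    using jump_count_filter [OF P, of "zero_hat P" ?es] zero_hat_least [OF P] filter_exponents [OF m]
    by (simp add: is_least_def)
  finally show ?thesis .
qed

lemma F_approx_converges:
  assumes "graded_poset P"
  shows "\<forall>\<^sub>F m in sequentially. mcoeff (F_approx P m :: 'k::field mfps) \<mu> = mcoeff (F P) \<mu>"
    and mcoeff_F: "mcoeff (F P :: 'k mfps) \<mu> = of_nat (jump_count P (zero_hat P) (exponents \<mu>))"
proof -
  let ?c = "of_nat (jump_count P (zero_hat P) (exponents \<mu>)) :: 'k"
  obtain m0 where m0: "Poly_Mapping.keys \<mu> \<subseteq> {..<m0}"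
    using finite_nat_set_iff_bounded [of "Poly_Mapping.keys \<mu>"] by auto
  have ev: "\<forall>\<^sub>F m in sequentially. mcoeff (F_approx P m :: 'k mfps) \<mu> = ?c"
    unfolding eventually_sequentially
  proof (intro exI allI impI)
    fix m assume "m0 \<le> m"
    then show "mcoeff (F_approx P m :: 'k mfps) \<mu> = ?c"
      by (intro mcoeff_F_approx [OF assms]) (use m0 in auto)
  qed
  have "c = ?c" if "\<forall>\<^sub>F m in sequentially. mcoeff (F_approx P m :: 'k mfps) \<mu> = c" for c
    using eventually_happens' [OF _ eventually_conj [OF ev that]] by auto
  with ev have "(THE c. \<forall>\<^sub>F m in sequentially. mcoeff (F_approx P m :: 'k mfps) \<mu> = c) = ?c"
    by (rule the_equality)
  then show eq: "mcoeff (F P :: 'k mfps) \<mu> = ?c"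
    by (simp add: F_def)
  show "\<forall>\<^sub>F m in sequentially. mcoeff (F_approx P m :: 'k mfps) \<mu> = mcoeff (F P) \<mu>"
    unfolding eq by (rule ev)
qed

lemma F_in_QSym:
  assumes "graded_poset P" shows "(F P :: 'k::field mfps) \<in> QSym"
proof -
  have "sum_list (exponents \<mu>) \<le> rk_diff P (zero_hat P) (one_hat P)"
    if "mcoeff (F P :: 'k mfps) \<mu> \<noteq> 0" for \<mu>
  proof -
    have "jump_count P (zero_hat P) (exponents \<mu>) \<noteq> 0"
      using that unfolding mcoeff_F [OF assms] by (metis of_nat_0)
    then show ?thesis
      using jump_count_sum [OF assms] zero_hat_least [OF assms] unfolding is_least_def by fastforce
  qed
  then show ?thesis
    unfolding QSym_def by (auto simp: mcoeff_F [OF assms])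
qed

lemma QSym_add: "f \<in> QSym \<Longrightarrow> g \<in> QSym \<Longrightarrow> f + g \<in> QSym"
proof -
  assume f: "f \<in> QSym" and g: "g \<in> QSym"
  obtain d where d: "\<forall>\<mu>. mcoeff f \<mu> \<noteq> 0 \<longrightarrow> sum_list (exponents \<mu>) \<le> d"
    using f unfolding QSym_def by blast
  obtain d' where d': "\<forall>\<mu>. mcoeff g \<mu> \<noteq> 0 \<longrightarrow> sum_list (exponents \<mu>) \<le> d'"
    using g unfolding QSym_def by blast
  have "sum_list (exponents \<mu>) \<le> max d d'" if "mcoeff (f + g) \<mu> \<noteq> 0" for \<mu>
  proof -
    have "mcoeff f \<mu> \<noteq> 0 \<or> mcoeff g \<mu> \<noteq> 0"
      using that by (auto simp: plus_mfps.rep_eq)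
    then show ?thesis
      using d d' by (meson le_max_iff_disj)
  qed
  moreover have "mcoeff (f + g) \<mu> = mcoeff (f + g) \<nu>" if "exponents \<mu> = exponents \<nu>" for \<mu> \<nu>
  proof -
    have "mcoeff f \<mu> = mcoeff f \<nu>" "mcoeff g \<mu> = mcoeff g \<nu>"
      using f g that unfolding QSym_def by blast+
    then show ?thesis
      by (simp add: plus_mfps.rep_eq)
  qed
  ultimately show ?thesis unfolding QSym_def by blast
qed

lemma QSym_0: "0 \<in> QSym"
  by (simp add: QSym_def zero_mfps.rep_eq)

lemma F_B_in_BQSym:
  assumes "graded_poset P" shows "(F_B P :: 'k::field mfps poly) \<in> BQSym"
proof -
  have sum: "(\<Sum>x\<in>A. g x) \<in> QSym" if "\<And>x. x \<in> A \<Longrightarrow> g x \<in> QSym" for A and g :: "'a \<Rightarrow> 'k mfps"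
    using that by (induction A rule: infinite_finite_induct) (auto simp: QSym_0 QSym_add)
  have "coeff (monom (F (interval P x (one_hat P)) :: 'k mfps) k) n \<in> QSym" if "x \<in> Field P" for x k n
    using F_in_QSym [OF graded_upper_interval [OF assms that], where 'k = 'k] QSym_0 [where 'a = 'k]
    by simp
  then show ?thesis
    unfolding BQSym_def F_B_def mem_Collect_eq coeff_sum by (intro allI sum) blast
qed

lemma diamond_Some:
  "(Some (x, y), Some (x', y')) \<in> P \<diamondop> Q \<longleftrightarrow>
     x \<in> Field P - {zero_hat P} \<and> x' \<in> Field P - {zero_hat P} \<and>
     y \<in> Field Q - {zero_hat Q} \<and> y' \<in> Field Q - {zero_hat Q} \<and> (x, x') \<in> P \<and> (y, y') \<in> Q"
  and diamond_None_Some: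
  "(None, Some (x, y)) \<in> P \<diamondop> Q \<longleftrightarrow> x \<in> Field P - {zero_hat P} \<and> y \<in> Field Q - {zero_hat Q}"
  and diamond_None: "(p, None) \<in> P \<diamondop> Q \<longleftrightarrow> p = None"
  unfolding diamond_def by auto

lemma Field_diamond:
  assumes "graded_poset P" "graded_poset Q"
  shows "Field (P \<diamondop> Q) = insert None (Some ` ((Field P - {zero_hat P}) \<times> (Field Q - {zero_hat Q})))"
proof (intro set_eqI iffI)
  fix p assume "p \<in> Field (P \<diamondop> Q)"
  then show "p \<in> insert None (Some ` ((Field P - {zero_hat P}) \<times> (Field Q - {zero_hat Q})))"
    unfolding Field_def diamond_def by auto
next
  fix p assume p: "p \<in> insert None (Some ` ((Field P - {zero_hat P}) \<times> (Field Q - {zero_hat Q})))"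
  then have "(None, p) \<in> P \<diamondop> Q"
    by (auto simp: diamond_None diamond_None_Some)
  then show "p \<in> Field (P \<diamondop> Q)" by (rule FieldI2)
qed

lemma Partial_order_diamond:
  assumes P: "graded_poset P" and Q: "graded_poset Q"
  shows "Partial_order (P \<diamondop> Q)"
  unfolding partial_order_on_def preorder_on_def
proof (intro conjI)
  show "P \<diamondop> Q \<subseteq> Field (P \<diamondop> Q) \<times> Field (P \<diamondop> Q)"
    by (auto intro: FieldI1 FieldI2)
  show "Refl (P \<diamondop> Q)"
    unfolding refl_on_def Field_diamond [OF P Q]
    using graded_refl [OF P] graded_refl [OF Q] by (auto simp: diamond_None diamond_Some)
  show "trans (P \<diamondop> Q)"
  proof (rule transI)
    fix p q r assume pq: "(p, q) \<in> P \<diamondop> Q" and qr: "(q, r) \<in> P \<diamondop> Q"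
    show "(p, r) \<in> P \<diamondop> Q"
    proof (cases q)
      case None
      then show ?thesis using pq qr by (simp add: diamond_None)
    next
      case q: (Some _)
      obtain x y where xy: "q = Some (x, y)" using q by (cases q) auto
      obtain x' y' where r: "r = Some (x', y')" using qr xy diamond_None by (cases r) auto
      show ?thesis
      proof (cases p)
        case None
        then show ?thesis using qr unfolding xy r None diamond_Some diamond_None_Some by blast
      next
        case (Some u)
        obtain x'' y'' where p: "p = Some (x'', y'')" using Some by (cases u) auto
        show ?thesis
          using pq qr graded_trans [OF P, of x'' x x'] graded_trans [OF Q, of y'' y y']
          unfolding xy r p diamond_Some by blast
      qed
    qed
  qed
  show "antisym (P \<diamondop> Q)"
  proof (rule antisymI)
    fix p q assume pq: "(p, q) \<in> P \<diamondop> Q" and qp: "(q, p) \<in> P \<diamondop> Q"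
    show "p = q"
    proof (cases p)
      case None
      then show ?thesis using qp by (simp add: diamond_None)
    next
      case (Some u)
      obtain x y where p: "p = Some (x, y)" using Some by (cases u) auto
      obtain x' y' where q: "q = Some (x', y')" using pq p diamond_None by (cases q) auto
      show ?thesis
        using pq qp graded_antisym [OF P, of x x'] graded_antisym [OF Q, of y y']
        unfolding p q diamond_Some by blast
    qed
  qed
qed

lemma
  assumes P: "graded_poset P" and Q: "graded_poset Q"
  shows graded_diamond: "graded_poset (P \<diamondop> Q)"
    and zero_hat_diamond: "zero_hat (P \<diamondop> Q) = None"
    and is_rank_diamond:
      "is_rank (P \<diamondop> Q) (\<lambda>p. case p of None \<Rightarrow> 0 | Some (x, y) \<Rightarrow> rk P x + rk Q y - 1)"
      (is "is_rank _ ?\<rho>")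
proof -
  have po: "Partial_order (P \<diamondop> Q)"
    by (rule Partial_order_diamond [OF P Q])
  have least: "is_least (P \<diamondop> Q) None"
    unfolding is_least_def Field_diamond [OF P Q] by (auto simp: diamond_None diamond_None_Some)
  show zero: "zero_hat (P \<diamondop> Q) = None"
    by (rule zero_hat_eq [OF po least])
  have leP: "(zero_hat P, x) \<in> P" if "x \<in> Field P" for x
    using zero_hat_least [OF P] that unfolding is_least_def by blast
  have leQ: "(zero_hat Q, x) \<in> Q" if "x \<in> Field Q" for x
    using zero_hat_least [OF Q] that unfolding is_least_def by blast
  have topP: "one_hat P \<in> Field P" "\<And>x. x \<in> Field P \<Longrightarrow> (x, one_hat P) \<in> P"
    using one_hat_greatest [OF P] unfolding is_greatest_def by blast+
  have topQ: "one_hat Q \<in> Field Q" "\<And>x. x \<in> Field Q \<Longrightarrow> (x, one_hat Q) \<in> Q"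
    using one_hat_greatest [OF Q] unfolding is_greatest_def by blast+
  have upP: "z \<noteq> zero_hat P" if "(x, z) \<in> P" "x \<noteq> zero_hat P" for x z
    using that graded_antisym [OF P, of x z] leP [OF FieldI1 [OF that(1)]] by blast
  have upQ: "z \<noteq> zero_hat Q" if "(x, z) \<in> Q" "x \<noteq> zero_hat Q" for x z
    using that graded_antisym [OF Q, of x z] leQ [OF FieldI1 [OF that(1)]] by blast
  have "\<exists>t. is_greatest (P \<diamondop> Q) t"
  proof (cases "Field P - {zero_hat P} = {} \<or> Field Q - {zero_hat Q} = {}")
    case True
    then have "Field (P \<diamondop> Q) = {None}"
      unfolding Field_diamond [OF P Q] by auto
    then have "is_greatest (P \<diamondop> Q) None"
      unfolding is_greatest_def by (simp add: diamond_None)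
    then show ?thesis ..
  next
    case False
    then obtain x y where "x \<in> Field P" "x \<noteq> zero_hat P" "y \<in> Field Q" "y \<noteq> zero_hat Q"
      by blast
    then have "one_hat P \<noteq> zero_hat P" "one_hat Q \<noteq> zero_hat Q"
      using upP [OF topP(2)] upQ [OF topQ(2)] by blast+
    then have "is_greatest (P \<diamondop> Q) (Some (one_hat P, one_hat Q))"
      unfolding is_greatest_def Field_diamond [OF P Q] using topP topQ
      by (auto simp: diamond_None_Some diamond_Some)
    then show ?thesis ..
  qed
  moreover
  show rank: "is_rank (P \<diamondop> Q) ?\<rho>"
    unfolding is_rank_def zero
  proof (intro conjI allI impI)
    fix p q assume c: "covers (P \<diamondop> Q) p q"
    then have pq: "(p, q) \<in> P \<diamondop> Q" "p \<noteq> q"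
      and between: "\<And>r. (p, r) \<in> P \<diamondop> Q \<Longrightarrow> (r, q) \<in> P \<diamondop> Q \<Longrightarrow> r = p \<or> r = q"
      unfolding covers_def by blast+
    obtain x' y' where q: "q = Some (x', y')"
      using pq diamond_None by (cases q) auto
    have q': "x' \<in> Field P" "x' \<noteq> zero_hat P" "y' \<in> Field Q" "y' \<noteq> zero_hat Q"
      using FieldI2 [OF pq(1)] unfolding q Field_diamond [OF P Q] by auto
    have r': "(x', x') \<in> P" "(y', y') \<in> Q"
      using graded_refl [OF P] graded_refl [OF Q] q' by blast+
    show "?\<rho> q = ?\<rho> p + 1"
    proof (cases p)
      case None
      have "covers P (zero_hat P) x'"
        unfolding covers_def
      proof (intro conjI allI impI)
        show "(zero_hat P, x') \<in> P" "zero_hat P \<noteq> x'" using q' leP by blast+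
        fix z assume z: "(zero_hat P, z) \<in> P \<and> (z, x') \<in> P"
        then have "z \<in> Field P" by (blast intro: FieldI2)
        then show "z = zero_hat P \<or> z = x'"
          using between [of "Some (z, y')"] q' r' z
          unfolding None q diamond_None_Some diamond_Some by blast
      qed
      moreover have "covers Q (zero_hat Q) y'"
        unfolding covers_def
      proof (intro conjI allI impI)
        show "(zero_hat Q, y') \<in> Q" "zero_hat Q \<noteq> y'" using q' leQ by blast+
        fix z assume z: "(zero_hat Q, z) \<in> Q \<and> (z, y') \<in> Q"
        then have "z \<in> Field Q" by (blast intro: FieldI2)
        then show "z = zero_hat Q \<or> z = y'"
          using between [of "Some (x', z)"] q' r' z
          unfolding None q diamond_None_Some diamond_Some by blast
      qed
      ultimately have "rk P x' = 1" "rk Q y' = 1"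
        using is_rank_rk [OF P] is_rank_rk [OF Q] unfolding is_rank_def by auto
      then show ?thesis by (simp add: None q)
    next
      case (Some u)
      obtain x y where p: "p = Some (x, y)" using Some by (cases u) auto
      have xy: "x \<in> Field P" "x \<noteq> zero_hat P" "y \<in> Field Q" "y \<noteq> zero_hat Q"
          "(x, x') \<in> P" "(y, y') \<in> Q"
        using pq(1) unfolding p q diamond_Some by blast+
      have r: "(x, x) \<in> P" "(y, y) \<in> Q"
        using graded_refl [OF P] graded_refl [OF Q] xy by blast+
      have pos: "rk Q y > 0" "rk P x > 0"
        using is_rank_strict_mono [OF Q is_rank_rk [OF Q] leQ [OF xy(3)]] xy(4)
          is_rank_strict_mono [OF P is_rank_rk [OF P] leP [OF xy(1)]] xy(2) by auto
      have "x = x' \<or> y = y'"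
        using between [of "Some (x', y)"] xy q' r r' unfolding p q diamond_Some by blast
      then show ?thesis
      proof
        assume eq: "x = x'"
        have "covers Q y y'"
          unfolding covers_def
        proof (intro conjI allI impI)
          show "(y, y') \<in> Q" "y \<noteq> y'" using xy pq(2) eq unfolding p q by blast+
          fix z assume z: "(y, z) \<in> Q \<and> (z, y') \<in> Q"
          then have "z \<in> Field Q" "z \<noteq> zero_hat Q" using upQ xy by (blast intro: FieldI2)+
          then show "z = y \<or> z = y'"
            using between [of "Some (x, z)"] xy q' r r' z eq unfolding p q diamond_Some by blast
        qed
        then have "rk Q y' = rk Q y + 1"
          using is_rank_rk [OF Q] unfolding is_rank_def by blast
        then show ?thesis using pos eq by (simp add: p q)
      next
        assume eq: "y = y'"
        have "covers P x x'"
          unfolding covers_def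
        proof (intro conjI allI impI)
          show "(x, x') \<in> P" "x \<noteq> x'" using xy pq(2) eq unfolding p q by blast+
          fix z assume z: "(x, z) \<in> P \<and> (z, x') \<in> P"
          then have "z \<in> Field P" "z \<noteq> zero_hat P" using upP xy by (blast intro: FieldI2)+
          then show "z = x \<or> z = x'"
            using between [of "Some (z, y)"] xy q' r r' z eq unfolding p q diamond_Some by blast
        qed
        then have "rk P x' = rk P x + 1"
          using is_rank_rk [OF P] unfolding is_rank_def by blast
        then show ?thesis using pos eq by (simp add: p q)
      qed
    qed
  qed simp
  moreover have "finite (Field (P \<diamondop> Q))"
    unfolding Field_diamond [OF P Q] using graded_finite [OF P] graded_finite [OF Q] by simp
  ultimately show "graded_poset (P \<diamondop> Q)"
    unfolding graded_poset_def using po least by blast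
qed

end

theory Submission
  imports Defs
begin

text \<open>Above its new minimum, the diamond product is the Cartesian product of the two posets with
  their minima removed. So a summand of \<^term>\<open>F_B (P \<diamondop> Q)\<close> belongs to a pair \<open>(x, y)\<close> of
  non-minimal elements, and its upper interval is a Cartesian product
  \<open>[x, 1] \<times> [y, 1]\<close>. The claim then follows from two facts.

  First, \<^const>\<open>F\<close> is multiplicative on Cartesian products (\<open>F_mult\<close>): a multichain in a product is
  a pair of multichains, one in each factor, and as ranks add up its monomial is the product of the
  two monomials. This holds at every finite stage \<^const>\<open>F_approx\<close>. It passes to the limit because
  the coefficient of a monomial no longer changes once all the variables in it are present, and the
  divisors of a monomial involve no other variables.

  Second, the powers of \<open>s\<close> match: the rank of \<open>(x, y)\<close> in the diamond product is
  \<open>\<rho>(x) + \<rho>(y) - 1\<close>, since minimal pairs \<open>(x, y)\<close>, with \<open>\<rho>(x) = \<rho>(y) = 1\<close>, cover the new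
  minimum. Hence \<open>\<rho>(x, y) - 1 = (\<rho>(x) - 1) + (\<rho>(y) - 1)\<close>, and the double sum factors.\<close>

section \<open>Multiplicativity of the quasisymmetric function\<close>

lemma multichain_nth_in_Field:
  assumes P: "graded_poset P" and xs: "xs \<in> multichains P m" and i: "i \<le> m"
  shows "xs ! i \<in> Field P"
proof (cases "i = m")
  case True
  then show ?thesis
    using xs one_hat_greatest [OF P] by (simp add: multichains_def is_greatest_def)
next
  case False
  then have "(xs ! i, xs ! Suc i) \<in> P"
    using xs i by (simp add: multichains_def)
  then show ?thesis
    by (rule FieldI1)
qed

lemma mcoeff_F_eq_F_approx:
  assumes "graded_poset P" and "Poly_Mapping.keys \<mu> \<subseteq> {..<m}"
  shows "mcoeff (F P :: 'k::field mfps) \<mu> = mcoeff (F_approx P m) \<mu>"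
  by (simp add: mcoeff_F [OF assms(1)] mcoeff_F_approx [OF assms])

lemma keys_splits:
  assumes "(\<alpha>, \<beta>) \<in> splits \<mu>"
  shows "Poly_Mapping.keys \<alpha> \<subseteq> Poly_Mapping.keys \<mu>" "Poly_Mapping.keys \<beta> \<subseteq> Poly_Mapping.keys \<mu>"
  using assms by (auto simp: splits_def in_keys_iff lookup_add)

text \<open>The product of two posets is described by an isomorphism \<open>f\<close>, so that \<open>R\<close> need not have a
  type of pairs as its carrier.\<close>

locale poset_product =
  fixes P :: "'a rel" and Q :: "'b rel" and R :: "'c rel" and f :: "'a \<times> 'b \<Rightarrow> 'c"
  assumes P: "graded_poset P" and Q: "graded_poset Q" and R: "graded_poset R"
    and bij: "bij_betw f (Field P \<times> Field Q) (Field R)"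
    and order: "\<And>x y x' y'. \<lbrakk>x \<in> Field P; x' \<in> Field P; y \<in> Field Q; y' \<in> Field Q\<rbrakk> \<Longrightarrow>
      (f (x, y), f (x', y')) \<in> R \<longleftrightarrow> (x, x') \<in> P \<and> (y, y') \<in> Q"
    and rank: "\<And>x y. \<lbrakk>x \<in> Field P; y \<in> Field Q\<rbrakk> \<Longrightarrow> rk R (f (x, y)) = rk P x + rk Q y"
begin

lemma Partial_order_R: "Partial_order R"
  using R by (simp add: graded_poset_def)

lemma Field_R: "Field R = f ` (Field P \<times> Field Q)"
  using bij by (simp add: bij_betw_def)

lemma zero_hat_R: "zero_hat R = f (zero_hat P, zero_hat Q)"
proof (rule zero_hat_eq [OF Partial_order_R])
  show "is_least R (f (zero_hat P, zero_hat Q))"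
    using zero_hat_least [OF P] zero_hat_least [OF Q]
    unfolding is_least_def Field_R by (auto simp: order)
qed

lemma one_hat_R: "one_hat R = f (one_hat P, one_hat Q)"
proof (rule one_hat_eq [OF Partial_order_R])
  show "is_greatest R (f (one_hat P, one_hat Q))"
    using one_hat_greatest [OF P] one_hat_greatest [OF Q]
    unfolding is_greatest_def Field_R by (auto simp: order)
qed

lemma rk_diff_R:
  assumes "(x, x') \<in> P" "(y, y') \<in> Q"
  shows "rk_diff R (f (x, y)) (f (x', y')) = rk_diff P x x' + rk_diff Q y y'"
proof -
  have "x \<in> Field P" "x' \<in> Field P" "y \<in> Field Q" "y' \<in> Field Q"
    using assms by (auto intro: FieldI1 FieldI2)
  then show ?thesis
    using rk_mono [OF P assms(1)] rk_mono [OF Q assms(2)] by (simp add: rk_diff_def rank)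
qed

lemma bij_multichains:
  "bij_betw (\<lambda>(xs, ys). map f (zip xs ys)) (multichains P m \<times> multichains Q m) (multichains R m)"
proof (rule bij_betwI')
  fix p q assume p: "p \<in> multichains P m \<times> multichains Q m"
    and q: "q \<in> multichains P m \<times> multichains Q m"
  obtain xs ys where p_eq: "p = (xs, ys)" by (cases p)
  obtain xs' ys' where q_eq: "q = (xs', ys')" by (cases q)
  have len: "length xs = Suc m" "length ys = Suc m" "length xs' = Suc m" "length ys' = Suc m"
    using p q by (auto simp: p_eq q_eq multichains_def)
  have "xs ! i = xs' ! i \<and> ys ! i = ys' ! i"
    if eq: "map f (zip xs ys) = map f (zip xs' ys')" and i: "i < Suc m" for i
  proof -
    have "f (xs ! i, ys ! i) = f (xs' ! i, ys' ! i)"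
      using arg_cong [OF eq, of "\<lambda>zs. zs ! i"] len i by simp
    moreover have "(xs ! i, ys ! i) \<in> Field P \<times> Field Q" "(xs' ! i, ys' ! i) \<in> Field P \<times> Field Q"
      using p q i multichain_nth_in_Field [OF P] multichain_nth_in_Field [OF Q]
      by (auto simp: p_eq q_eq)
    ultimately show ?thesis
      using bij by (auto simp: bij_betw_def dest: inj_onD)
  qed
  then show "((case p of (xs, ys) \<Rightarrow> map f (zip xs ys)) = (case q of (xs, ys) \<Rightarrow> map f (zip xs ys)))
      \<longleftrightarrow> p = q"
    using len by (auto simp: p_eq q_eq intro: nth_equalityI)
next
  fix p assume p: "p \<in> multichains P m \<times> multichains Q m"
  obtain xs ys where p_eq: "p = (xs, ys)" by (cases p)
  have "xs ! i \<in> Field P" "ys ! i \<in> Field Q" if "i \<le> m" for i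
    using p that multichain_nth_in_Field [OF P] multichain_nth_in_Field [OF Q]
    by (auto simp: p_eq)
  then show "(case p of (xs, ys) \<Rightarrow> map f (zip xs ys)) \<in> multichains R m"
    using p by (simp add: p_eq multichains_def zero_hat_R one_hat_R order)
next
  fix zs assume zs: "zs \<in> multichains R m"
  have "\<forall>i\<le>m. \<exists>p. p \<in> Field P \<times> Field Q \<and> zs ! i = f p"
    using multichain_nth_in_Field [OF R zs] unfolding Field_R by blast
  then obtain g where g: "\<And>i. i \<le> m \<Longrightarrow> g i \<in> Field P \<times> Field Q \<and> zs ! i = f (g i)"
    by metis
  define xs where "xs = map (fst \<circ> g) [0..<Suc m]"
  define ys where "ys = map (snd \<circ> g) [0..<Suc m]"
  have nth: "xs ! i = fst (g i)" "ys ! i = snd (g i)" if "i \<le> m" for i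
    using that by (simp_all add: xs_def ys_def del: upt_Suc)
  have fld: "xs ! i \<in> Field P" "ys ! i \<in> Field Q" "zs ! i = f (xs ! i, ys ! i)" if "i \<le> m" for i
    using g [OF that] by (auto simp: nth [OF that])
  have inj: "inj_on f (Field P \<times> Field Q)"
    using bij by (rule bij_betw_imp_inj_on)
  have ends: "zero_hat P \<in> Field P" "zero_hat Q \<in> Field Q" "one_hat P \<in> Field P" "one_hat Q \<in> Field Q"
    using zero_hat_least [OF P] zero_hat_least [OF Q] one_hat_greatest [OF P] one_hat_greatest [OF Q]
    by (auto simp: is_least_def is_greatest_def)
  have "(xs ! 0, ys ! 0) = (zero_hat P, zero_hat Q)"
    by (rule inj_onD [OF inj])
       (use zs fld [of 0] ends in \<open>auto simp: multichains_def zero_hat_R\<close>)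
  moreover have "(xs ! m, ys ! m) = (one_hat P, one_hat Q)"
    by (rule inj_onD [OF inj])
       (use zs fld [of m] ends in \<open>auto simp: multichains_def one_hat_R\<close>)
  moreover have "(xs ! i, xs ! Suc i) \<in> P \<and> (ys ! i, ys ! Suc i) \<in> Q" if "i < m" for i
  proof -
    have "(zs ! i, zs ! Suc i) \<in> R"
      using zs that by (simp add: multichains_def)
    then show ?thesis
      using fld [of i] fld [of "Suc i"] that by (simp add: order)
  qed
  moreover have len: "length xs = Suc m" "length ys = Suc m"
    by (simp_all add: xs_def ys_def)
  ultimately have "(xs, ys) \<in> multichains P m \<times> multichains Q m"
    by (simp add: multichains_def)
  moreover have "zs = map f (zip xs ys)"
    by (rule nth_equalityI) (use zs fld len in \<open>auto simp: multichains_def\<close>)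
  ultimately show "\<exists>p\<in>multichains P m \<times> multichains Q m.
      zs = (case p of (xs, ys) \<Rightarrow> map f (zip xs ys))"
    by force
qed

lemma F_approx_mult: "(F_approx R m :: 'k::field mfps) = F_approx P m * F_approx Q m"
proof -
  let ?t = "\<lambda>A zs. \<Prod>i<m. (tvar i :: 'k mfps) ^ rk_diff A (zs ! i) (zs ! Suc i)"
  have "F_approx R m = (\<Sum>(xs, ys)\<in>multichains P m \<times> multichains Q m. ?t R (map f (zip xs ys)))"
    unfolding F_approx_def
    by (subst sum.reindex_bij_betw [OF bij_multichains, symmetric]) (simp add: case_prod_unfold)
  also have "\<dots> = (\<Sum>(xs, ys)\<in>multichains P m \<times> multichains Q m. ?t P xs * ?t Q ys)"
  proof (rule sum.cong [OF refl], clarify)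
    fix xs ys assume "xs \<in> multichains P m" "ys \<in> multichains Q m"
    then show "?t R (map f (zip xs ys)) = ?t P xs * ?t Q ys"
      unfolding prod.distrib [symmetric]
      by (intro prod.cong refl) (simp add: multichains_def rk_diff_R power_add)
  qed
  also have "\<dots> = F_approx P m * F_approx Q m"
    by (simp add: F_approx_def sum_product sum.cartesian_product)
  finally show ?thesis .
qed

lemma F_mult: "(F R :: 'k::field mfps) = F P * F Q"
proof (rule mfps_eqI)
  fix \<mu> :: "nat \<Rightarrow>\<^sub>0 nat"
  obtain m where m: "Poly_Mapping.keys \<mu> \<subseteq> {..<m}"
    using finite_nat_set_iff_bounded [of "Poly_Mapping.keys \<mu>"] by auto
  have "mcoeff (F R :: 'k mfps) \<mu> = mcoeff (F_approx P m * F_approx Q m) \<mu>"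
    by (simp add: mcoeff_F_eq_F_approx [OF R m] F_approx_mult)
  also have "\<dots> = mcoeff (F P * F Q) \<mu>"
    unfolding times_mfps.rep_eq
  proof (rule sum.cong [OF refl], clarify)
    fix \<alpha> \<beta> assume "(\<alpha>, \<beta>) \<in> splits \<mu>"
    then have "Poly_Mapping.keys \<alpha> \<subseteq> {..<m}" "Poly_Mapping.keys \<beta> \<subseteq> {..<m}"
      using keys_splits m by blast+
    then show "mcoeff (F_approx P m) \<alpha> * mcoeff (F_approx Q m) \<beta>
        = (mcoeff (F P) \<alpha> * mcoeff (F Q) \<beta> :: 'k)"
      by (simp add: mcoeff_F_eq_F_approx P Q)
  qed
  finally show "mcoeff (F R :: 'k mfps) \<mu> = mcoeff (F P * F Q) \<mu>" .
qed

end

section \<open>Upper intervals of the diamond product\<close>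

lemma upper_interval_iff:
  assumes P: "graded_poset P"
  shows "(a, b) \<in> interval P x (one_hat P) \<longleftrightarrow> (x, a) \<in> P \<and> (a, b) \<in> P"
proof -
  have "(z, one_hat P) \<in> P" if "(x, z) \<in> P" for z
    using one_hat_greatest [OF P] that unfolding is_greatest_def by (auto intro: FieldI2)
  then show ?thesis
    unfolding interval_def using graded_trans [OF P, of x a b] by blast
qed

lemma above_nonzero:
  assumes P: "graded_poset P" and "(x, z) \<in> P" "x \<noteq> zero_hat P"
  shows "z \<in> Field P - {zero_hat P}"
  using assms zero_hat_least [OF P] graded_antisym [OF P, of x "zero_hat P"]
  unfolding is_least_def by (auto intro: FieldI1 FieldI2)

lemma rk_pos:
  assumes P: "graded_poset P" and "x \<in> Field P - {zero_hat P}"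
  shows "0 < rk P x"
proof -
  have "rk P (zero_hat P) < rk P x"
    by (rule is_rank_strict_mono [OF P is_rank_rk [OF P]])
       (use assms zero_hat_least [OF P] in \<open>auto simp: is_least_def\<close>)
  then show ?thesis by simp
qed

lemma rk_diamond:
  assumes P: "graded_poset P" and Q: "graded_poset Q"
    and "x \<in> Field P - {zero_hat P}" "y \<in> Field Q - {zero_hat Q}"
  shows "rk (P \<diamondop> Q) (Some (x, y)) = rk P x + rk Q y - 1"
  using rk_eq [OF graded_diamond [OF P Q] is_rank_diamond [OF P Q], of "Some (x, y)"] assms(3,4)
  by (simp add: Field_diamond [OF P Q])

text \<open>The shift by one in the rank of the diamond product cancels in the rank differences that make
  up the rank function of an interval.\<close>

lemma poset_product_upper_interval:
  assumes P: "graded_poset P" and Q: "graded_poset Q"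
    and x: "x \<in> Field P - {zero_hat P}" and y: "y \<in> Field Q - {zero_hat Q}"
  shows "poset_product (interval P x (one_hat P)) (interval Q y (one_hat Q))
    (interval (P \<diamondop> Q) (Some (x, y)) (one_hat (P \<diamondop> Q))) Some"
proof -
  have D: "graded_poset (P \<diamondop> Q)"
    by (rule graded_diamond [OF P Q])
  have xD: "Some (x, y) \<in> Field (P \<diamondop> Q)"
    using x y by (simp add: Field_diamond [OF P Q])
  have xP: "x \<in> Field P" and yQ: "y \<in> Field Q"
    using x y by simp_all
  have nonzero: "a \<in> Field P - {zero_hat P}" "b \<in> Field Q - {zero_hat Q}"
    if "(x, a) \<in> P" "(y, b) \<in> Q" for a b
    using that x y above_nonzero [OF P] above_nonzero [OF Q] by blast+
  note flds = Field_upper_interval [OF P xP] Field_upper_interval [OF Q yQ]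
    Field_upper_interval [OF D xD]
  have above: "(Some (x, y), Some (a, b)) \<in> P \<diamondop> Q \<longleftrightarrow> (x, a) \<in> P \<and> (y, b) \<in> Q" for a b
    using nonzero x y unfolding diamond_Some by blast
  show ?thesis
  proof (rule poset_product.intro)
    show "graded_poset (interval P x (one_hat P))"
      by (rule graded_upper_interval [OF P xP])
    show "graded_poset (interval Q y (one_hat Q))"
      by (rule graded_upper_interval [OF Q yQ])
    show "graded_poset (interval (P \<diamondop> Q) (Some (x, y)) (one_hat (P \<diamondop> Q)))"
      by (rule graded_upper_interval [OF D xD])
  next
    have "{z. (Some (x, y), z) \<in> P \<diamondop> Q} = Some ` ({a. (x, a) \<in> P} \<times> {b. (y, b) \<in> Q})"
    proof (intro set_eqI iffI)
      fix z assume z: "z \<in> {z. (Some (x, y), z) \<in> P \<diamondop> Q}"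
      then obtain a b where "z = Some (a, b)" by (cases z) (auto simp: diamond_None)
      then show "z \<in> Some ` ({a. (x, a) \<in> P} \<times> {b. (y, b) \<in> Q})"
        using z by (simp add: above)
    qed (auto simp: above)
    then show "bij_betw Some (Field (interval P x (one_hat P)) \<times> Field (interval Q y (one_hat Q)))
        (Field (interval (P \<diamondop> Q) (Some (x, y)) (one_hat (P \<diamondop> Q))))"
      by (simp add: flds bij_betw_def)
  next
    fix a b a' b'
    assume "a \<in> Field (interval P x (one_hat P))" "a' \<in> Field (interval P x (one_hat P))"
      "b \<in> Field (interval Q y (one_hat Q))" "b' \<in> Field (interval Q y (one_hat Q))"
    then have "(x, a) \<in> P" "(x, a') \<in> P" "(y, b) \<in> Q" "(y, b') \<in> Q"
      by (simp_all add: flds)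
    then show "(Some (a, b), Some (a', b')) \<in> interval (P \<diamondop> Q) (Some (x, y)) (one_hat (P \<diamondop> Q))
        \<longleftrightarrow> (a, a') \<in> interval P x (one_hat P) \<and> (b, b') \<in> interval Q y (one_hat Q)"
      using nonzero [of a b] nonzero [of a' b'] x y
      by (simp add: upper_interval_iff P Q D above diamond_Some)
  next
    fix a b
    assume "a \<in> Field (interval P x (one_hat P))" "b \<in> Field (interval Q y (one_hat Q))"
    then have ab: "(x, a) \<in> P" "(y, b) \<in> Q"
      by (simp_all add: flds)
    have abD: "(Some (x, y), Some (a, b)) \<in> P \<diamondop> Q"
      using ab by (simp add: above)
    show "rk (interval (P \<diamondop> Q) (Some (x, y)) (one_hat (P \<diamondop> Q))) (Some (a, b))
        = rk (interval P x (one_hat P)) a + rk (interval Q y (one_hat Q)) b"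
      unfolding rk_upper_interval [OF D xD abD] rk_upper_interval [OF P xP ab(1)]
        rk_upper_interval [OF Q yQ ab(2)] rk_diamond [OF P Q x y] rk_diamond [OF P Q nonzero [OF ab]]
      using rk_pos [OF P x] rk_pos [OF Q y] rk_mono [OF P ab(1)] rk_mono [OF Q ab(2)] by linarith
  qed
qed

section \<open>Type B quasisymmetric functions of diamond products\<close>

theorem theorem13p3:
  fixes P :: "'a rel" and Q :: "'b rel"
  assumes "graded_poset P" and "graded_poset Q"
  shows "(F_B (P \<diamondop> Q) :: 'k::field mfps poly) = F_B P * F_B Q"
proof -
  let ?A = "Field P - {zero_hat P}" and ?B = "Field Q - {zero_hat Q}"
  let ?D = "P \<diamondop> Q"
  let ?F = "\<lambda>x. F (interval P x (one_hat P)) :: 'k mfps"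
  let ?G = "\<lambda>y. F (interval Q y (one_hat Q)) :: 'k mfps"
  let ?H = "\<lambda>p. monom (F (interval ?D p (one_hat ?D)) :: 'k mfps) (rk ?D p - 1)"
  have "Field ?D - {zero_hat ?D} = Some ` (?A \<times> ?B)"
    unfolding Field_diamond [OF assms] zero_hat_diamond [OF assms] by auto
  then have "F_B ?D = (\<Sum>(x, y)\<in>?A \<times> ?B. ?H (Some (x, y)))"
    by (simp add: F_B_def sum.reindex case_prod_unfold)
  also have "\<dots> = (\<Sum>(x, y)\<in>?A \<times> ?B. monom (?F x) (rk P x - 1) * monom (?G y) (rk Q y - 1))"
  proof (rule sum.cong [OF refl])
    fix p assume "p \<in> ?A \<times> ?B"
    then obtain x y where p: "p = (x, y)" and x: "x \<in> ?A" and y: "y \<in> ?B"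
      by blast
    have "rk ?D (Some (x, y)) - 1 = (rk P x - 1) + (rk Q y - 1)"
      using rk_pos [OF assms(1) x] rk_pos [OF assms(2) y] by (simp add: rk_diamond [OF assms x y])
    then have "?H (Some (x, y)) = monom (?F x) (rk P x - 1) * monom (?G y) (rk Q y - 1)"
      by (simp add: mult_monom poset_product.F_mult [OF poset_product_upper_interval [OF assms x y]])
    then show "(case p of (x, y) \<Rightarrow> ?H (Some (x, y)))
        = (case p of (x, y) \<Rightarrow> monom (?F x) (rk P x - 1) * monom (?G y) (rk Q y - 1))"
      by (simp add: p)
  qed
  also have "\<dots> = F_B P * F_B Q"
    by (simp add: F_B_def sum_product sum.cartesian_product)
  finally show ?thesis .
qed

end
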